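(* Let $f:\mathbb{R}^n\to\mathbb{R}$, let $x_0\in\mathbb{R}^n$, $\alpha_0>0$, and let $D\subset\mathbb{R}^n$ be a finite nonempty set. The forcing constant initialization algorithm, which outputs $(x_0,\alpha_0,c)$ with $$c=1+\max\left\{0,\ \frac{f(x_0)-\min_{d\in D}f(x_0+\alpha_0d)}{\alpha_0^2}\right\},$$ produces a triple satisfying $$f(x_0+\alpha_0d)>f(x_0)-c\alpha_0^2\quad\text{for all } d\in D.$$ Its complexity is $|D|$ function evaluations (not counting the evaluation of $f(x_0)$).
   Context: The forcing constant initialization algorithm takes as input $x_0\in\mathbb{R}^n$, $\alpha_0>0$ and $D$, evaluates $f(x_0+\alpha_0 d)$ for all $d\in D$, and outputs the unchanged $x_0,\alpha_0$ together with the number $c$ given by the formula in the claim. Its complexity is the number of evaluations of $f$ it uses. *)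

theory Defs
  imports "HOL-Analysis.Analysis"
begin

text \<open>
  Algorithms that access a real-valued objective function only through evaluations at points.
  Such an algorithm is a tree that either stops with an output or asks for the function value at a
  point and continues depending on the answer.  The objective function is not an input of the
  algorithm; it only appears when the algorithm is run.
\<close>

datatype ('x, 'r) eval_algorithm =
    Output 'r
  | Evaluate 'x "real \<Rightarrow> ('x, 'r) eval_algorithm"

primrec output_of :: "('x \<Rightarrow> real) \<Rightarrow> ('x, 'r) eval_algorithm \<Rightarrow> 'r" where
  "output_of f (Output r) = r"
| "output_of f (Evaluate x k) = output_of f (k (f x))"

text \<open>The points at which \<open>f\<close> is evaluated, in order, repeated evaluations being repeated.\<close>

primrec evaluations :: "('x \<Rightarrow> real) \<Rightarrow> ('x, 'r) eval_algorithm \<Rightarrow> 'x list" where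
  "evaluations f (Output r) = []"
| "evaluations f (Evaluate x k) = x # evaluations f (k (f x))"

text \<open>Evaluate at all points of a list and continue with the list of values obtained.\<close>

primrec evaluate_all ::
    "'x list \<Rightarrow> (real list \<Rightarrow> ('x, 'r) eval_algorithm) \<Rightarrow> ('x, 'r) eval_algorithm" where
  "evaluate_all [] k = k []"
| "evaluate_all (x # xs) k = Evaluate x (\<lambda>v. evaluate_all xs (\<lambda>vs. k (v # vs)))"

text \<open>
  The finite set of directions is passed as a list, which fixes the order in which the trial points
  are visited.
\<close>

definition forcing_constant_init ::
    "real ^ 'n \<Rightarrow> real \<Rightarrow> (real ^ 'n) list \<Rightarrow> (real ^ 'n, (real ^ 'n) \<times> real \<times> real) eval_algorithm" where
  "forcing_constant_init x0 \<alpha>0 ds =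
     Evaluate x0 (\<lambda>v0.
       evaluate_all (map (\<lambda>d. x0 + \<alpha>0 *\<^sub>R d) ds) (\<lambda>vs.
         Output (x0, \<alpha>0, 1 + max 0 ((v0 - Min (set vs)) / \<alpha>0\<^sup>2))))"

text \<open>
  Number of evaluations when one evaluation at \<open>x0\<close> is free.  Only a single occurrence of \<open>x0\<close> is
  discounted: if 0 is among the directions, then \<open>x0\<close> is also a trial point, and that
  evaluation counts.
\<close>

definition complexity_not_counting ::
    "'x \<Rightarrow> ('x \<Rightarrow> real) \<Rightarrow> ('x, 'r) eval_algorithm \<Rightarrow> nat" where
  "complexity_not_counting x0 f A = length (remove1 x0 (evaluations f A))"

end

theory Submission
  imports Defs
begin

text \<open>Let m be the least trial value. The summand 1 makes c strictly larger than (f(x0) - m) /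
  \<alpha>0^2; multiplying by the positive number \<alpha>0^2 gives f(x0) - c \<alpha>0^2 < m, and m
  bounds every trial value from below. This is \<open>sufficient_decrease_fails\<close>. The two
  lemmas on \<open>evaluate_all\<close> reduce a run of the algorithm to plain lists, from which its
  output and the number of its evaluations can be read off.\<close>

lemma output_of_evaluate_all [simp]:
  "output_of f (evaluate_all xs k) = output_of f (k (map f xs))"
  by (induction xs arbitrary: k) simp_all

lemma evaluations_evaluate_all [simp]:
  "evaluations f (evaluate_all xs k) = xs @ evaluations f (k (map f xs))"
  by (induction xs arbitrary: k) simp_all

text \<open>Here u stands for f(x0), m for the least trial value, v for any trial value and a for
  the step size. Strictness comes from the summand 1 alone, since the maximum may equal the
  quotient.\<close>

lemma sufficient_decrease_fails:
  fixes a :: real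
  assumes "a > 0" and "m \<le> v"
  shows "v > u - (1 + max 0 ((u - m) / a\<^sup>2)) * a\<^sup>2"
proof -
  have pos: "a\<^sup>2 > 0"
    using assms(1) by simp
  have "(u - m) / a\<^sup>2 < 1 + max 0 ((u - m) / a\<^sup>2)"
    by linarith
  then have "u - m < (1 + max 0 ((u - m) / a\<^sup>2)) * a\<^sup>2"
    using pos by (simp only: pos_divide_less_eq)
  with assms(2) show ?thesis
    by linarith
qed

theorem lemma6:
  fixes f :: "real ^ 'n \<Rightarrow> real"
    and x0 :: "real ^ 'n"
    and \<alpha>0 :: real
    and D :: "(real ^ 'n) set"
    and ds :: "(real ^ 'n) list"
  assumes "\<alpha>0 > 0"
    and "finite D" and "D \<noteq> {}"
    and "distinct ds" and "set ds = D"
  shows "(\<exists>c. output_of f (forcing_constant_init x0 \<alpha>0 ds) = (x0, \<alpha>0, c)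
            \<and> c = 1 + max 0 ((f x0 - (MIN d\<in>D. f (x0 + \<alpha>0 *\<^sub>R d))) / \<alpha>0\<^sup>2)
            \<and> (\<forall>d\<in>D. f (x0 + \<alpha>0 *\<^sub>R d) > f x0 - c * \<alpha>0\<^sup>2))
         \<and> complexity_not_counting x0 f (forcing_constant_init x0 \<alpha>0 ds) = card D"
proof -
  define m where "m = (MIN d\<in>D. f (x0 + \<alpha>0 *\<^sub>R d))"
  define c where "c = 1 + max 0 ((f x0 - m) / \<alpha>0\<^sup>2)"
  \<comment> \<open>The algorithm minimizes over the set of a doubly mapped list;
    \<open>image_image\<close> fuses the two images into the one over \<open>D\<close> in
    \<open>m\<close>.\<close>
  have "output_of f (forcing_constant_init x0 \<alpha>0 ds) = (x0, \<alpha>0, c)"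
    using \<open>set ds = D\<close> by (simp add: forcing_constant_init_def c_def m_def image_image)
  moreover have "\<forall>d\<in>D. f (x0 + \<alpha>0 *\<^sub>R d) > f x0 - c * \<alpha>0\<^sup>2"
  proof
    fix d assume "d \<in> D"
    with \<open>finite D\<close> have "m \<le> f (x0 + \<alpha>0 *\<^sub>R d)"
      unfolding m_def by (intro Min_le) auto
    with \<open>\<alpha>0 > 0\<close> show "f (x0 + \<alpha>0 *\<^sub>R d) > f x0 - c * \<alpha>0\<^sup>2"
      unfolding c_def by (rule sufficient_decrease_fails)
  qed
  \<comment> \<open>The first evaluation is at \<open>x0\<close>, so \<open>remove1\<close> strips
    exactly the head, even if 0 lies in \<open>D\<close>. One trial point per entry of
    \<open>ds\<close> remains, and distinctness turns the length into a cardinality.\<close>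
  moreover have "complexity_not_counting x0 f (forcing_constant_init x0 \<alpha>0 ds) = card D"
    using distinct_card[OF \<open>distinct ds\<close>] \<open>set ds = D\<close>
    by (simp add: complexity_not_counting_def forcing_constant_init_def)
  ultimately show ?thesis
    unfolding c_def m_def by blast
qed

end
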